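(* Let $(P_\alpha)$ be a net of probability measures on $(S,\mathcal{B}_e)$ and $P$ a probability measure on $(S,\mathcal{B}_e)$. Let $D:=D(E_0\times\mathbb{Q},P\circ\phi^{-1})$ be the countable set of radii constructed in the context. Then the following statements (1)–(3) are equivalent: (1) $P_\alpha\to_w P$ in $(S,\tau_e)$. (2) $\lim_\alpha P_\alpha\big(\bigcap_{j=1}^m\{I_{\overline{B}(x_j,r_j)}\le r_j+\alpha_j\}\big)=P\big(\bigcap_{j=1}^m\{I_{(\overline{B}(x_j,r_j))^0}\le r_j+\alpha_j\}\big)$ for all $m\in\mathbb{N}$, $x_1,\ldots,x_m\in E_0$, $r_1,\ldots,r_m\in D$, $\alpha_1,\ldots,\alpha_m\in\mathbb{Q}$. (3) $\lim_\alpha P_\alpha\big(\bigcap_{j=1}^m\{I_{\overline{B}(x_j,r_j)}> r_j+\alpha_j\}\big)=P\big(\bigcap_{j=1}^m\{I_{(\overline{B}(x_j,r_j))^0}> r_j+\alpha_j\}\big)$ for all $m\in\mathbb{N}$, $x_1,\ldots,x_m\in E_0$, $r_1,\ldots,r_m\in D$, $\alpha_1,\ldots,\alpha_m\in\mathbb{Q}$. (Here the closed balls $\overline{B}(x_j,r_j)$ satisfy the continuity condition $P(I_{\overline{B}(x_j,r_j)}\le r_j+\alpha_j)=P(I_{(\overline{B}(x_j,r_j))^0}<r_j+\alpha_j)$.)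
   Context: $(E,\mathcal{G})$ is a locally compact second countable Hausdorff space and $\mathcal{K}$ the family of its compact subsets. $S$ is the set of all lower semicontinuous functions $f:E\to[-\infty,\infty]$. For $A\subseteq E$, $I_A:S\to[-\infty,\infty]$, $I_A(f)=\inf_{x\in A}f(x)$ (with $\inf\emptyset=\infty$); $\{I_A\le a\}$ denotes $\{f\in S: I_A(f)\le a\}$, and similarly for $<,>,\ge$. The epi-topology $\tau_e$ is the coarsest topology on $S$ for which $I_K$ is lower semicontinuous for all $K\in\mathcal{K}$ and $I_G$ is upper semicontinuous for all $G\in\mathcal{G}$; $\mathcal{B}_e=\sigma(\tau_e)$. Weak convergence $P_\alpha\to_w P$ in $(S,\tau_e)$ of a net of Borel probability measures means $\liminf_\alpha P_\alpha(O)\ge P(O)$ for all $O\in\tau_e$. $A^0$ denotes the interior of $A$. Fix a metric $d$ on $E$ inducing $\mathcal{G}$ such that every $d$-bounded set is relatively compact (it exists by Vaughan's theorem), and a countable dense subset $E_0\subseteq E$. $\overline{B}(x,r)=\{y\in E:d(x,y)\le r\}$ for $x \in E$, $r\in\mathbb{R}$ (empty if $r<0$). On $E\times\mathbb{R}$ use the metric $(d\times u)((x,a),(y,b))=\max\{d(x,y),|a-b|\}$, with closed balls $\overline{B}_{d\times u}((x,a),r)$ (empty if $r<0$); these are compact. $\mathcal{F}(E\times\mathbb{R})$ is the family of closed subsets of $E\times\mathbb{R}$ with the Fell topology, generated by the sets $\{F: F\cap K=\emptyset\}$, $K$ compact, and $\{F:F\cap G\neq\emptyset\}$, $G$ open in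 $E\times\mathbb{R}$. For $B\subseteq E\times\mathbb{R}$, $\mathcal{H}(B)=\{F\in\mathcal{F}(E\times\mathbb{R}):F\cap B\neq\emptyset\}$. The map $\phi(f)=\mathrm{epi}(f)=\{(x,a)\in E\times\mathbb{R}:f(x)\le a\}$ is a homeomorphism from $(S,\tau_e)$ onto its (compact) image in $\mathcal{F}(E\times\mathbb{R})$, and $Q:=P\circ\phi^{-1}$ is regarded as a Borel probability measure on $\mathcal{F}(E\times\mathbb{R})$. A compact $K\subseteq E\times\mathbb{R}$ is a $Q$-continuity set if the boundary of $\mathcal{H}(K)$ in the Fell topology has $Q$-measure $0$; equivalently, $Q(\mathcal{H}(K))=Q(\mathcal{H}(K^0))$. Construction of $D=D(E_0\times\mathbb{Q},Q)$: let $\mathbb{Q}_+$ be the set of positive rationals. For $z\in E_0\times\mathbb{Q}$, $r\in\mathbb{Q}_+$ let $R_\pm(z,r)=\{s>0:\overline{B}_{d\times u}(z,r\pm s)\text{ is a }Q\text{-continuity set}\}$, and let $R$ be the intersection of all $R_+(z,r)$ and all $R_-(z,r)$ over $z\in E_0\times\mathbb{Q}$, $r\in\mathbb{Q}_+$; $R$ has countable complement in $(0,\infty)$. Fix a sequence $(s_k)_{k\in\mathbb{N}}$ in $R$ with $s_k\downarrow0$ and put $D=\{r+s_k:r\in\mathbb{Q}_+,k\in\mathbb{N}\}\cup\{r-s_k:r\in\mathbb{Q}_+,k\in\mathbb{N}\}$. *)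

theory Defs
  imports "HOL-Probability.Probability"
begin

definition lower_semicontinuous :: "'a topology \<Rightarrow> ('a \<Rightarrow> ereal) \<Rightarrow> bool" where
  "lower_semicontinuous X f \<longleftrightarrow> (\<forall>a. openin X {x \<in> topspace X. a < f x})"

definition upper_semicontinuous :: "'a topology \<Rightarrow> ('a \<Rightarrow> ereal) \<Rightarrow> bool" where
  "upper_semicontinuous X f \<longleftrightarrow> (\<forall>a. openin X {x \<in> topspace X. f x < a})"

definition lsc_functions :: "('a::topological_space \<Rightarrow> ereal) set" where
  "lsc_functions = {f. lower_semicontinuous euclidean f}"

(* The infimum over the empty set is \<infinity>, the top element of ereal. *)
definition inf_over :: "'a set \<Rightarrow> ('a \<Rightarrow> ereal) \<Rightarrow> ereal" where
  "inf_over A f = (INF x\<in>A. f x)"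

definition epi_topology :: "('a::topological_space \<Rightarrow> ereal) topology" where
  "epi_topology = topology_generated_by
     ({{f \<in> lsc_functions. a < inf_over K f} | K a. compact K} \<union>
      {{f \<in> lsc_functions. inf_over G f < a} | G a. open G})"

lemma topspace_epi_topology: "topspace epi_topology = lsc_functions"
proof -
  have "(lsc_functions :: ('a \<Rightarrow> ereal) set) \<in> {{f \<in> lsc_functions. a < inf_over K f} | K a. compact K}"
    by (auto simp: inf_over_def top_ereal_def intro!: exI[of _ "{}"] exI[of _ "0::ereal"])
  then show ?thesis
    unfolding epi_topology_def topology_generated_by_topspace
    by (intro equalityI Union_least Union_upper UnI1) auto
qed

lemma lower_semicontinuous_inf_over:
  assumes "compact K"
  shows "lower_semicontinuous epi_topology (inf_over K)"
proof -
  have "openin epi_topology {f \<in> lsc_functions. a < inf_over K f}" for a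
    unfolding epi_topology_def by (rule topology_generated_by_Basis) (use assms in blast)
  then show ?thesis
    by (simp add: lower_semicontinuous_def topspace_epi_topology)
qed

lemma upper_semicontinuous_inf_over:
  assumes "open G"
  shows "upper_semicontinuous epi_topology (inf_over G)"
proof -
  have "openin epi_topology {f \<in> lsc_functions. inf_over G f < a}" for a
    unfolding epi_topology_def by (rule topology_generated_by_Basis) (use assms in blast)
  then show ?thesis
    by (simp add: upper_semicontinuous_def topspace_epi_topology)
qed

lemma epi_topology_coarsest:
  assumes "topspace X = lsc_functions"
    and "\<And>K. compact K \<Longrightarrow> lower_semicontinuous X (inf_over K)"
    and "\<And>G. open G \<Longrightarrow> upper_semicontinuous X (inf_over G)"
    and "openin epi_topology U"
  shows "openin X U"
proof (rule generate_topology_on_coarsest[where T = "openin X"])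
  show "generate_topology_on
     ({{f \<in> lsc_functions. a < inf_over K f} | K a. compact K} \<union>
      {{f \<in> lsc_functions. inf_over G f < a} | G a. open G}) U"
    using assms(4) unfolding epi_topology_def by (rule openin_topology_generated_by)
next
  fix V :: "('a \<Rightarrow> ereal) set"
  assume "V \<in> {{f \<in> lsc_functions. a < inf_over K f} | K a. compact K} \<union>
      {{f \<in> lsc_functions. inf_over G f < a} | G a. open G}"
  then consider K a where "compact K" "V = {f \<in> lsc_functions. a < inf_over K f}"
    | G a where "open G" "V = {f \<in> lsc_functions. inf_over G f < a}"
    by blast
  then show "openin X V"
  proof cases
    case 1
    then show ?thesis
      using assms(1) assms(2)[of K] by (simp add: lower_semicontinuous_def)
  next
    case 2
    then show ?thesis
      using assms(1) assms(3)[of G] by (simp add: upper_semicontinuous_def)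
  qed
qed simp

definition borel_of :: "'a topology \<Rightarrow> 'a measure" where
  "borel_of X = sigma (topspace X) {U. openin X U}"

(* A net is a family indexed by a type 'i with a directed preorder le; its limits
   are limits along the filter generated by the tails {b. le a b}. *)
definition directed_preorder :: "('i \<Rightarrow> 'i \<Rightarrow> bool) \<Rightarrow> bool" where
  "directed_preorder le \<longleftrightarrow> reflp le \<and> transp le \<and> (\<forall>a b. \<exists>c. le a c \<and> le b c)"

definition net_filter :: "('i \<Rightarrow> 'i \<Rightarrow> bool) \<Rightarrow> 'i filter" where
  "net_filter le = (INF a. principal {b. le a b})"

lemma eventually_net_filter:
  assumes "directed_preorder le"
  shows "eventually P (net_filter le) \<longleftrightarrow> (\<exists>a. \<forall>b. le a b \<longrightarrow> P b)"
proof -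
  have "\<exists>x\<in>UNIV. principal {b. le x b} \<le> principal {b. le a b} \<sqinter> principal {b. le c b}" for a c
  proof -
    obtain x where "le a x" "le c x"
      using assms unfolding directed_preorder_def by metis
    moreover have "transp le"
      using assms by (simp add: directed_preorder_def)
    ultimately have "{b. le x b} \<subseteq> {b. le a b} \<inter> {b. le c b}"
      by (auto dest: transpD)
    then show ?thesis by auto
  qed
  then show ?thesis
    unfolding net_filter_def by (subst eventually_INF_base) (auto simp: eventually_principal)
qed

definition weakly_converges ::
    "'b topology \<Rightarrow> ('i \<Rightarrow> 'b measure) \<Rightarrow> 'b measure \<Rightarrow> 'i filter \<Rightarrow> bool" where
  "weakly_converges X Pn P F \<longleftrightarrow>
     (\<forall>U. openin X U \<longrightarrow> emeasure P U \<le> Liminf F (\<lambda>i. emeasure (Pn i) U))"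

definition hit_sets :: "'b::topological_space set \<Rightarrow> 'b set set" where
  "hit_sets B = {F. closed F \<and> F \<inter> B \<noteq> {}}"

definition fell_topology :: "'b::topological_space set topology" where
  "fell_topology = topology_generated_by
     ({{F. closed F \<and> F \<inter> K = {}} | K. compact K} \<union> {hit_sets G | G. open G})"

lemma topspace_fell_topology: "topspace fell_topology = {F. closed F}"
proof -
  have "{F. closed F} \<in> {{F. closed F \<and> F \<inter> K = {}} | K. compact K}"
    by (auto intro!: exI[of _ "{}"])
  then show ?thesis
    unfolding fell_topology_def topology_generated_by_topspace hit_sets_def
    by (intro equalityI Union_least Union_upper UnI1) auto
qed

definition epigraph :: "('a \<Rightarrow> ereal) \<Rightarrow> ('a \<times> real) set" where
  "epigraph f = {(x, a). f x \<le> ereal a}"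

definition epigraph_distr ::
    "('a::topological_space \<Rightarrow> ereal) measure \<Rightarrow> ('a \<times> real) set measure" where
  "epigraph_distr P = distr P (borel_of fell_topology) epigraph"

definition continuity_set :: "'b::topological_space set measure \<Rightarrow> 'b set \<Rightarrow> bool" where
  "continuity_set Q K \<longleftrightarrow>
     compact K \<and> emeasure Q (fell_topology frontier_of (hit_sets K)) = 0"

definition max_metric :: "('a \<Rightarrow> 'a \<Rightarrow> real) \<Rightarrow> 'a \<times> real \<Rightarrow> 'a \<times> real \<Rightarrow> real" where
  "max_metric d = (\<lambda>(x, a) (y, b). max (d x y) \<bar>a - b\<bar>)"

(* Closed balls of the metric d on the whole type, which need not be its canonical dist;
   they are empty for negative radii. *)
abbreviation closed_ball :: "('a \<Rightarrow> 'a \<Rightarrow> real) \<Rightarrow> 'a \<Rightarrow> real \<Rightarrow> 'a set" where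
  "closed_ball d \<equiv> Metric_space.mcball UNIV d"

definition proper_metric_for_topology :: "('a::topological_space \<Rightarrow> 'a \<Rightarrow> real) \<Rightarrow> bool" where
  "proper_metric_for_topology d \<longleftrightarrow>
     Metric_space UNIV d \<and> Metric_space.mtopology UNIV d = euclidean \<and>
     (\<forall>B. Metric_space.mbounded UNIV d B \<longrightarrow> compact (closure B))"

definition admissible_shifts ::
    "('a::topological_space \<Rightarrow> 'a \<Rightarrow> real) \<Rightarrow> 'a set \<Rightarrow> ('a \<times> real) set measure \<Rightarrow> real set" where
  "admissible_shifts d E0 Q =
     {s. 0 < s \<and> (\<forall>z \<in> E0 \<times> \<rat>. \<forall>r \<in> \<rat>. 0 < r \<longrightarrow>
            continuity_set Q (closed_ball (max_metric d) z (r + s)) \<and>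
            continuity_set Q (closed_ball (max_metric d) z (r - s)))}"

definition radii :: "(nat \<Rightarrow> real) \<Rightarrow> real set" where
  "radii s = {r + s k | r k. r \<in> \<rat> \<and> 0 < r} \<union> {r - s k | r k. r \<in> \<rat> \<and> 0 < r}"

end

theory Submission
  imports Defs
begin

text \<open>For \<open>t = (x, r, \<alpha>)\<close> with \<open>x \<in> E0\<close>, \<open>r \<in> D\<close> and \<open>\<alpha> \<in> \<rat>\<close> let \<open>H t\<close> be the set of all \<open>f\<close> whose infimum over the
closed ball around \<open>x\<close> of radius \<open>r\<close> is at most \<open>r + \<alpha>\<close>. A cell is a finite intersection of sets \<open>H t\<close>
and complements of such sets. There are countably many cells, and each of the three statements is
equivalent to the convergence of the probabilities of all cells.

From cells to weak convergence: every open set of the epi-topology is a union of cells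
(\<open>epi_open_contains_cell\<close>), because arbitrarily small radii, a dense set of centres and, once the radius is
chosen, a dense set of levels are available. Cells are closed under intersection, so by
inclusion-exclusion convergence on cells passes to their finite unions. Finite unions exhaust an open
set \<open>U\<close>, which gives the lower bound for the limit inferior of the probabilities of \<open>U\<close>
(\<open>weakly_converges_if_converges_on_base\<close>).

From weak convergence to cells: \<open>f\<close> lies in \<open>H t\<close> exactly if its epigraph meets the closed ball \<open>K\<close> of the
maximum metric around \<open>(x, \<alpha>)\<close> of radius \<open>r\<close>, and the radii are chosen such that the frontier of the sets
hitting \<open>K\<close> is null. This frontier contains every closed set that meets \<open>K\<close> but not its interior
(\<open>interior_of_hit_sets_subset\<close>). The epigraph map is continuous into the Fell topology, hence measurable, so
the null set can be pulled back: the closed set \<open>H t\<close> differs by a \<open>P\<close>-null set from the open set of those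
\<open>f\<close> that are strictly below \<open>r + \<alpha>\<close> somewhere in the interior of the ball (\<open>continuity_set_AE\<close>). The
Portmanteau argument then yields convergence on cells. The sets in the limits lie between these two
sets, so the limits are the probabilities of the intersections of the \<open>H t\<close>, or of their complements.

Finally, the intersections of the \<open>H t\<close> alone determine the probabilities of all cells by successive
subtraction, and so do the intersections of the complements (\<open>converges_on_cells_if_left\<close>).\<close>

section \<open>Weak convergence and convergence on single sets\<close>

lemma space_borel_of: "space (borel_of X) = topspace X"
  by (simp add: borel_of_def space_measure_of_conv)

lemma openin_sets_borel_of: "openin X U \<Longrightarrow> U \<in> sets (borel_of X)"
  unfolding borel_of_def
  by (subst sets_measure_of) (auto dest: openin_subset)

lemma closedin_sets_borel_of: "closedin X C \<Longrightarrow> C \<in> sets (borel_of X)"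
proof -
  assume "closedin X C"
  then have "topspace X - (topspace X - C) = C" "openin X (topspace X - C)"
    by (auto dest: closedin_subset)
  then show ?thesis
    by (metis openin_sets_borel_of sets.compl_sets space_borel_of)
qed

locale prob_net =
  fixes X :: "'b topology" and Pn :: "'i \<Rightarrow> 'b measure" and P :: "'b measure" and F :: "'i filter"
  assumes prob_Pn: "prob_space (Pn i)" and sets_Pn: "sets (Pn i) = sets (borel_of X)"
    and prob_P: "prob_space P" and sets_P: "sets P = sets (borel_of X)"
begin

sublocale P: prob_space P by (rule prob_P)
sublocale Pn: prob_space "Pn i" for i by (rule prob_Pn)

lemma space_P: "space P = topspace X" "space (Pn i) = topspace X"
  using sets_eq_imp_space_eq[OF sets_P] sets_eq_imp_space_eq[OF sets_Pn] by (simp_all add: space_borel_of)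

lemma sets_Pn_eq: "sets (Pn i) = sets P"
  by (simp add: sets_Pn sets_P)

definition converges_on :: "'b set \<Rightarrow> bool" where
  "converges_on A \<longleftrightarrow> A \<in> sets P \<and> ((\<lambda>i. measure (Pn i) A) \<longlongrightarrow> measure P A) F"

lemma weakly_converges_iff_measure:
  "weakly_converges X Pn P F \<longleftrightarrow>
     (\<forall>U c. openin X U \<and> c < measure P U \<longrightarrow> (\<forall>\<^sub>F i in F. c < measure (Pn i) U))"
proof -
  have "emeasure P U \<le> Liminf F (\<lambda>i. emeasure (Pn i) U) \<longleftrightarrow>
        (\<forall>c < measure P U. \<forall>\<^sub>F i in F. c < measure (Pn i) U)" for U
  proof
    assume L: "emeasure P U \<le> Liminf F (\<lambda>i. emeasure (Pn i) U)"
    show "\<forall>c < measure P U. \<forall>\<^sub>F i in F. c < measure (Pn i) U"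
    proof (intro allI impI)
      fix c assume c: "c < measure P U"
      show "\<forall>\<^sub>F i in F. c < measure (Pn i) U"
      proof (cases "c < 0")
        case True
        then show ?thesis by (intro always_eventually allI) (meson less_le_trans measure_nonneg)
      next
        case False
        with c have "ennreal c < emeasure P U"
          by (simp add: P.emeasure_eq_measure ennreal_less_iff)
        then have "\<forall>\<^sub>F i in F. ennreal c < emeasure (Pn i) U"
          using L by (simp add: le_Liminf_iff)
        then show ?thesis
          by (rule eventually_mono) (use False in \<open>simp add: Pn.emeasure_eq_measure ennreal_less_iff\<close>)
      qed
    qed
  next
    assume R: "\<forall>c < measure P U. \<forall>\<^sub>F i in F. c < measure (Pn i) U"
    show "emeasure P U \<le> Liminf F (\<lambda>i. emeasure (Pn i) U)"
      unfolding le_Liminf_iff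
    proof (intro allI impI)
      fix y assume y: "y < emeasure P U"
      then obtain c where c: "y = ennreal c" "0 \<le> c"
        by (cases y) (auto simp: top_unique)
      then have "c < measure P U"
        using y by (simp add: P.emeasure_eq_measure ennreal_less_iff)
      with R have "\<forall>\<^sub>F i in F. c < measure (Pn i) U" by blast
      then show "\<forall>\<^sub>F i in F. y < emeasure (Pn i) U"
        by (rule eventually_mono) (use c in \<open>simp add: Pn.emeasure_eq_measure ennreal_less_iff\<close>)
    qed
  qed
  then show ?thesis by (auto simp: weakly_converges_def)
qed

text \<open>The Portmanteau sandwich: the lower bound comes from the open set \<open>U\<close> inside \<open>A\<close>, the upper bound
from the complement of the closed set \<open>C\<close> around \<open>A\<close>, and both bounds are \<open>measure P A\<close>
because \<open>C - U\<close> is null.\<close>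

lemma weakly_converges_imp_converges_on:
  assumes "weakly_converges X Pn P F"
    and "openin X U" "closedin X C" "U \<subseteq> A" "A \<subseteq> C" "A \<in> sets P"
    and null: "measure P (C - U) = 0"
  shows "converges_on A"
proof -
  have [measurable]: "U \<in> sets P" "C \<in> sets P"
    using assms by (auto simp: sets_P openin_sets_borel_of closedin_sets_borel_of)
  then have sets_n: "U \<in> sets (Pn i)" "C \<in> sets (Pn i)" "A \<in> sets (Pn i)" for i
    using assms by (simp_all add: sets_Pn_eq)
  have weak: "\<forall>\<^sub>F i in F. c < measure (Pn i) V" if "openin X V" "c < measure P V" for V c
    using assms(1) that by (simp add: weakly_converges_iff_measure)
  have "measure P C = measure P U"
    using null assms P.finite_measure_Diff[of C U] by simp
  then have PA: "measure P A = measure P U" "measure P A = measure P C"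
    using P.finite_measure_mono[of U A] P.finite_measure_mono[of A C] assms by auto
  have "((\<lambda>i. measure (Pn i) A) \<longlongrightarrow> measure P A) F"
  proof (rule order_tendstoI)
    fix c assume "c < measure P A"
    then have "\<forall>\<^sub>F i in F. c < measure (Pn i) U"
      using weak[of U c] assms PA by simp
    then show "\<forall>\<^sub>F i in F. c < measure (Pn i) A"
      by (rule eventually_mono)
         (use Pn.finite_measure_mono[OF assms(4)] sets_n in \<open>auto intro: less_le_trans\<close>)
  next
    fix c assume "measure P A < c"
    then have "1 - c < measure P (topspace X - C)"
      using P.prob_compl[of C] PA by (simp add: space_P)
    then have "\<forall>\<^sub>F i in F. 1 - c < measure (Pn i) (topspace X - C)"
      using weak[of "topspace X - C" "1 - c"] assms by blast
    then show "\<forall>\<^sub>F i in F. measure (Pn i) A < c"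
    proof (rule eventually_mono)
      fix i assume "1 - c < measure (Pn i) (topspace X - C)"
      then show "measure (Pn i) A < c"
        using Pn.prob_compl[of C i] sets_n Pn.finite_measure_mono[OF assms(5), of i]
        by (simp add: space_P)
    qed
  qed
  with assms show ?thesis by (simp add: converges_on_def)
qed

lemma converges_on_topspace: "converges_on (topspace X)"
  using P.prob_space Pn.prob_space sets.top[of P] by (simp add: converges_on_def space_P)

lemma converges_on_Diff:
  assumes "converges_on A" "converges_on B" "B \<subseteq> A"
  shows "converges_on (A - B)"
  using assms tendsto_diff[of "\<lambda>i. measure (Pn i) A" "measure P A" F "\<lambda>i. measure (Pn i) B" "measure P B"]
  by (auto simp: converges_on_def P.finite_measure_Diff Pn.finite_measure_Diff sets_Pn_eq)

lemma converges_on_Un: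
  assumes "converges_on A" "converges_on B" "converges_on (A \<inter> B)"
  shows "converges_on (A \<union> B)"
proof -
  \<comment> \<open>The union is built from complements and proper differences, the operations known so far.\<close>
  have AB: "A \<union> B = topspace X - ((topspace X - A) - (B - A \<inter> B))"
    using sets.sets_into_space[of A P] sets.sets_into_space[of B P] assms
    by (auto simp: converges_on_def space_P)
  have sub: "A \<subseteq> topspace X" "B - A \<inter> B \<subseteq> topspace X - A"
    using sets.sets_into_space[of A P] sets.sets_into_space[of B P] assms
    by (auto simp: converges_on_def space_P)
  have "converges_on (B - A \<inter> B)" by (rule converges_on_Diff) (use assms in auto)
  then show ?thesis
    unfolding AB using assms sub
    by (intro converges_on_Diff converges_on_topspace) auto
qed

text \<open>Inclusion-exclusion, one set at a time: \<open>C n\<close> meets \<open>\<Union>k<n. C k\<close> in a union of \<open>n\<close> members of the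
intersection-closed family, which is why the induction must let \<open>C\<close> vary.\<close>

lemma converges_on_finite_UN:
  assumes "\<And>k. C k \<in> \<C>" "\<And>A B. A \<in> \<C> \<Longrightarrow> B \<in> \<C> \<Longrightarrow> A \<inter> B \<in> \<C>"
    and "\<And>A. A \<in> \<C> \<Longrightarrow> converges_on A"
  shows "converges_on (\<Union>k<n::nat. C k)"
  using assms(1)
proof (induction n arbitrary: C)
  case 0
  show ?case by (simp add: converges_on_def)
next
  case (Suc n)
  have "C n \<inter> (\<Union>k<n. C k) = (\<Union>k<n. C n \<inter> C k)" by blast
  then have "converges_on (C n \<inter> (\<Union>k<n. C k))"
    using Suc.IH[of "\<lambda>k. C n \<inter> C k"] Suc.prems assms(2) by simp
  then show ?case
    unfolding lessThan_Suc using Suc assms(3) by (auto intro: converges_on_Un)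
qed

text \<open>An open set \<open>U\<close> is the increasing union of finite unions of members of \<open>\<C>\<close>. A finite union whose
\<open>P\<close>-measure is close to that of \<open>U\<close> keeps this measure along the net, and it bounds \<open>U\<close> from below.\<close>

lemma weakly_converges_if_converges_on_base:
  assumes "countable \<C>" "\<And>A B. A \<in> \<C> \<Longrightarrow> B \<in> \<C> \<Longrightarrow> A \<inter> B \<in> \<C>"
    and conv: "\<And>A. A \<in> \<C> \<Longrightarrow> converges_on A"
    and base: "\<And>U f. openin X U \<Longrightarrow> f \<in> U \<Longrightarrow> \<exists>A\<in>\<C>. f \<in> A \<and> A \<subseteq> U"
  shows "weakly_converges X Pn P F"
  unfolding weakly_converges_iff_measure
proof (intro allI impI, elim conjE)
  fix U c assume U: "openin X U" and c: "c < measure P U"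
  show "\<forall>\<^sub>F i in F. c < measure (Pn i) U"
  proof (cases "U = {}")
    case True
    then show ?thesis using c by simp
  next
    case False
    define \<A> where "\<A> = {A \<in> \<C>. A \<subseteq> U}"
    have "countable \<A>" "\<A> \<noteq> {}" and UA: "\<Union>\<A> = U"
      using assms(1) False base[OF U] unfolding \<A>_def
      by (simp add: countable_Collect, blast, blast)
    define C where "C = from_nat_into \<A>"
    have C: "C k \<in> \<C>" "C k \<subseteq> U" for k
      using from_nat_into[OF \<open>\<A> \<noteq> {}\<close>, of k] by (auto simp: C_def \<A>_def)
    have "range C = \<A>"
      unfolding C_def using \<open>\<A> \<noteq> {}\<close> \<open>countable \<A>\<close> by (rule range_from_nat_into)
    then have U_eq: "(\<Union>n. \<Union>k<n. C k) = U"
      using UA by blast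
    have Cn: "converges_on (\<Union>k<n. C k)" for n
      by (rule converges_on_finite_UN[of C \<C>]) (use C assms in auto)
    have "(\<lambda>n. measure P (\<Union>k<n. C k)) \<longlonglongrightarrow> measure P (\<Union>n. \<Union>k<n. C k)"
      using Cn by (intro P.finite_Lim_measure_incseq)
        (auto simp: converges_on_def incseq_def intro: less_le_trans)
    then have "\<forall>\<^sub>F n in sequentially. c < measure P (\<Union>k<n. C k)"
      using c U_eq by (simp add: order_tendsto_iff)
    then obtain n where "c < measure P (\<Union>k<n. C k)"
      by (auto simp: eventually_sequentially)
    then have "\<forall>\<^sub>F i in F. c < measure (Pn i) (\<Union>k<n. C k)"
      using Cn[of n] by (simp add: converges_on_def order_tendsto_iff)
    then show ?thesis
    proof (rule eventually_mono)
      fix i assume "c < measure (Pn i) (\<Union>k<n. C k)"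
      also have "\<dots> \<le> measure (Pn i) U"
        using C(2) U by (intro Pn.finite_measure_mono) (auto simp: sets_Pn openin_sets_borel_of)
      finally show "c < measure (Pn i) U" .
    qed
  qed
qed

end

section \<open>Cells\<close>

text \<open>The ambient set \<open>\<Omega>\<close> is the cell without any condition, and complements are taken relative to it.\<close>

definition cell :: "'b set \<Rightarrow> ('t \<Rightarrow> 'b set) \<Rightarrow> 't set \<Rightarrow> 't set \<Rightarrow> 'b set" where
  "cell \<Omega> H I J = {f \<in> \<Omega>. (\<forall>t\<in>I. f \<in> H t) \<and> (\<forall>t\<in>J. f \<notin> H t)}"

lemma cell_Int: "cell \<Omega> H I J \<inter> cell \<Omega> H I' J' = cell \<Omega> H (I \<union> I') (J \<union> J')"
  by (auto simp: cell_def)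

lemma cell_insert_right: "cell \<Omega> H I (insert j J) = cell \<Omega> H I J - cell \<Omega> H (insert j I) J"
  by (auto simp: cell_def)

lemma cell_complement: "cell \<Omega> (\<lambda>t. \<Omega> - H t) I J = cell \<Omega> H J I"
  by (auto simp: cell_def)

lemma cell_eq_INT: "I \<noteq> {} \<Longrightarrow> (\<And>t. t \<in> I \<Longrightarrow> H t \<subseteq> \<Omega>) \<Longrightarrow> cell \<Omega> H I {} = (\<Inter>t\<in>I. H t)"
  by (auto simp: cell_def)

lemma openin_cell_left:
  assumes "finite I" "\<And>t. t \<in> I \<Longrightarrow> openin X (G t)"
  shows "openin X (cell (topspace X) G I {})"
proof -
  have "cell (topspace X) G I {} = (\<Inter>t\<in>I. G t) \<inter> topspace X" by (auto simp: cell_def)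
  then show ?thesis
    using assms by (cases "I = {}") auto
qed

lemma closedin_cell_left:
  assumes "\<And>t. t \<in> I \<Longrightarrow> closedin X (H t)"
  shows "closedin X (cell (topspace X) H I {})"
proof -
  have "cell (topspace X) H I {} = \<Inter>(insert (topspace X) (H ` I))"
    by (auto simp: cell_def)
  moreover have "closedin X (\<Inter>(insert (topspace X) (H ` I)))"
    using assms by (intro closedin_Inter) auto
  ultimately show ?thesis by simp
qed

context prob_net
begin

text \<open>Excluded sets are removed one by one with \<open>cell \<Omega> H I (insert j J) = cell \<Omega> H I J - cell \<Omega> H (insert j I) J\<close>,
so a family of convergence statements without exclusions determines all the others.\<close>

lemma converges_on_cells_if_left:
  assumes "\<And>I. finite I \<Longrightarrow> I \<subseteq> T \<Longrightarrow> converges_on (cell (topspace X) H I {})"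
    and "finite I" "finite J" "I \<subseteq> T" "J \<subseteq> T"
  shows "converges_on (cell (topspace X) H I J)"
  using assms(3,2,4,5)
proof (induction J arbitrary: I)
  case empty
  then show ?case using assms(1) by simp
next
  case (insert j J)
  then have "converges_on (cell (topspace X) H I J)" "converges_on (cell (topspace X) H (insert j I) J)"
    by simp_all
  then show ?case
    unfolding cell_insert_right by (rule converges_on_Diff) (auto simp: cell_def)
qed

lemma converges_on_cells_if_Inter:
  assumes "\<And>I. finite I \<Longrightarrow> I \<noteq> {} \<Longrightarrow> I \<subseteq> T \<Longrightarrow> converges_on (\<Inter>t\<in>I. H t)"
    and "\<And>t. t \<in> T \<Longrightarrow> H t \<subseteq> topspace X"
    and "finite I" "finite J" "I \<subseteq> T" "J \<subseteq> T"
  shows "converges_on (cell (topspace X) H I J)"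
proof (rule converges_on_cells_if_left[of T])
  fix I assume I: "finite I" "I \<subseteq> T"
  show "converges_on (cell (topspace X) H I {})"
  proof (cases "I = {}")
    case True
    then show ?thesis by (simp add: cell_def converges_on_topspace)
  next
    case False
    then show ?thesis
      using assms(1,2) I by (subst cell_eq_INT) auto
  qed
qed (use assms in auto)

end

text \<open>The pairs \<open>G t \<subseteq> H t\<close> express that every \<open>H t\<close> is a closed \<open>P\<close>-continuity set: up to a null set it agrees
with an open subset. Together with the requirement that the cells form a base, this makes weak
convergence equivalent to convergence on cells.\<close>

locale cell_base = prob_net X Pn P F
  for X :: "'b topology" and Pn :: "'i \<Rightarrow> 'b measure" and P F +
  fixes T :: "'t set" and H G :: "'t \<Rightarrow> 'b set"
  assumes countable_T: "countable T"
    and closedin_H: "t \<in> T \<Longrightarrow> closedin X (H t)"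
    and openin_G: "t \<in> T \<Longrightarrow> openin X (G t)"
    and G_subset_H: "t \<in> T \<Longrightarrow> G t \<subseteq> H t"
    and AE_H_imp_G: "t \<in> T \<Longrightarrow> AE f in P. f \<in> H t \<longrightarrow> f \<in> G t"
    and base: "openin X U \<Longrightarrow> f \<in> U \<Longrightarrow>
      \<exists>I J. finite I \<and> finite J \<and> I \<subseteq> T \<and> J \<subseteq> T \<and> f \<in> cell (topspace X) H I J \<and> cell (topspace X) H I J \<subseteq> U"
begin

lemma sets_HG: "t \<in> T \<Longrightarrow> H t \<in> sets P" "t \<in> T \<Longrightarrow> G t \<in> sets P"
  by (simp_all add: sets_P closedin_sets_borel_of openin_sets_borel_of closedin_H openin_G)

lemma H_subset_topspace: "t \<in> T \<Longrightarrow> H t \<subseteq> topspace X"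
  using closedin_H closedin_subset by blast

lemma AE_H_iff_G:
  assumes "t \<in> T"
  shows "AE f in P. f \<in> H t \<longleftrightarrow> f \<in> G t"
  using AE_H_imp_G[OF assms] by eventually_elim (use G_subset_H[OF assms] in blast)

text \<open>Replacing \<open>H\<close> by \<open>G\<close> in the positive conditions gives an open subset of a cell; replacing it in the
negative conditions gives a closed superset. The Portmanteau sandwich applies.\<close>

lemma converges_on_cells_if_weakly_converges:
  assumes "weakly_converges X Pn P F" "finite I" "finite J" "I \<subseteq> T" "J \<subseteq> T"
  shows "converges_on (cell (topspace X) H I J)"
proof -
  define U where "U = cell (topspace X) G I {} \<inter> cell (topspace X) (\<lambda>t. topspace X - H t) J {}"
  define C where "C = cell (topspace X) H I {} \<inter> cell (topspace X) (\<lambda>t. topspace X - G t) J {}"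
  have UC: "openin X U" "closedin X C"
    unfolding U_def C_def using assms closedin_H openin_G
    by (intro openin_Int closedin_Int openin_cell_left closedin_cell_left closedin_diff openin_diff;
        auto)+
  have sub: "U \<subseteq> cell (topspace X) H I J" "cell (topspace X) H I J \<subseteq> C"
    using assms(4,5) G_subset_H by (auto simp: U_def C_def cell_def subset_iff)
  have "cell (topspace X) H I J = cell (topspace X) H I {} \<inter> (topspace X - (\<Union>t\<in>J. H t))"
    by (auto simp: cell_def)
  moreover have "topspace X - (\<Union>t\<in>J. H t) \<in> sets P"
    using assms sets_HG by (metis (no_types) sets.compl_sets sets.finite_UN space_P(1) subsetD)
  moreover have "cell (topspace X) H I {} \<in> sets P"
    using assms closedin_H by (simp add: sets_P closedin_sets_borel_of closedin_cell_left subset_iff)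
  ultimately have "cell (topspace X) H I J \<in> sets P" by simp
  moreover have "measure P (C - U) = 0"
  proof -
    have "AE f in P. \<forall>t\<in>I \<union> J. f \<in> H t \<longleftrightarrow> f \<in> G t"
      using assms AE_H_iff_G by (intro AE_finite_allI) auto
    then have "AE f in P. f \<in> C - U \<longleftrightarrow> f \<in> {}"
      by eventually_elim (auto simp: C_def U_def cell_def)
    then have "measure P (C - U) = measure P {}"
      by (rule measure_eq_AE)
         (use UC in \<open>auto simp: sets_P closedin_sets_borel_of openin_sets_borel_of\<close>)
    then show ?thesis by simp
  qed
  ultimately show ?thesis
    using weakly_converges_imp_converges_on[OF assms(1) UC sub] by blast
qed

lemma weakly_converges_if_converges_on_cells:
  assumes "\<And>I J. finite I \<Longrightarrow> finite J \<Longrightarrow> I \<subseteq> T \<Longrightarrow> J \<subseteq> T \<Longrightarrow> converges_on (cell (topspace X) H I J)"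
  shows "weakly_converges X Pn P F"
proof (rule weakly_converges_if_converges_on_base)
  let ?S = "{I. finite I \<and> I \<subseteq> T}"
  let ?\<C> = "(\<lambda>(I, J). cell (topspace X) H I J) ` (?S \<times> ?S)"
  show "countable ?\<C>"
    using countable_T by (intro countable_image countable_SIGMA countable_Collect_finite_subset)
  show "A \<inter> B \<in> ?\<C>" if "A \<in> ?\<C>" "B \<in> ?\<C>" for A B
  proof -
    from that obtain I J I' J' where IJ: "I \<in> ?S" "J \<in> ?S" "I' \<in> ?S" "J' \<in> ?S"
      and "A = cell (topspace X) H I J" "B = cell (topspace X) H I' J'"
      by blast
    then have "A \<inter> B = cell (topspace X) H (I \<union> I') (J \<union> J')"
      by (simp only: cell_Int)
    then show ?thesis using IJ by (intro image_eqI[of _ _ "(I \<union> I', J \<union> J')"]) auto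
  qed
  show "converges_on A" if "A \<in> ?\<C>" for A
    using that assms by auto
  show "\<exists>A\<in>?\<C>. f \<in> A \<and> A \<subseteq> U" if "openin X U" "f \<in> U" for U f
  proof -
    obtain I J where "I \<in> ?S" "J \<in> ?S" "f \<in> cell (topspace X) H I J" "cell (topspace X) H I J \<subseteq> U"
      using base[OF \<open>openin X U\<close> \<open>f \<in> U\<close>] by blast
    then show ?thesis by (intro bexI[of _ "cell (topspace X) H I J"]) auto
  qed
qed

text \<open>Intersections of the \<open>H t\<close> alone suffice, because they determine all cells. By symmetry so do the
intersections of the complements, which generate the same cells.\<close>

theorem weakly_converges_iff_Inter:
  "weakly_converges X Pn P F \<longleftrightarrow>
     (\<forall>I. finite I \<and> I \<noteq> {} \<and> I \<subseteq> T \<longrightarrow> converges_on (\<Inter>t\<in>I. H t))"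
proof
  assume "weakly_converges X Pn P F"
  then show "\<forall>I. finite I \<and> I \<noteq> {} \<and> I \<subseteq> T \<longrightarrow> converges_on (\<Inter>t\<in>I. H t)"
    using converges_on_cells_if_weakly_converges[of _ "{}"] cell_eq_INT[of _ H "topspace X"]
      H_subset_topspace by (metis empty_subsetI finite.emptyI subsetD)
next
  assume "\<forall>I. finite I \<and> I \<noteq> {} \<and> I \<subseteq> T \<longrightarrow> converges_on (\<Inter>t\<in>I. H t)"
  then show "weakly_converges X Pn P F"
    using H_subset_topspace
    by (intro weakly_converges_if_converges_on_cells converges_on_cells_if_Inter) auto
qed

theorem weakly_converges_iff_Inter_complement:
  "weakly_converges X Pn P F \<longleftrightarrow>
     (\<forall>I. finite I \<and> I \<noteq> {} \<and> I \<subseteq> T \<longrightarrow> converges_on (\<Inter>t\<in>I. topspace X - H t))"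
proof
  assume W: "weakly_converges X Pn P F"
  show "\<forall>I. finite I \<and> I \<noteq> {} \<and> I \<subseteq> T \<longrightarrow> converges_on (\<Inter>t\<in>I. topspace X - H t)"
  proof (intro allI impI, elim conjE)
    fix I assume "finite I" "I \<noteq> {}" "I \<subseteq> T"
    moreover from this have "(\<Inter>t\<in>I. topspace X - H t) = cell (topspace X) H {} I"
      by (auto simp: cell_def)
    ultimately show "converges_on (\<Inter>t\<in>I. topspace X - H t)"
      using converges_on_cells_if_weakly_converges[OF W] by simp
  qed
next
  assume A: "\<forall>I. finite I \<and> I \<noteq> {} \<and> I \<subseteq> T \<longrightarrow> converges_on (\<Inter>t\<in>I. topspace X - H t)"
  show "weakly_converges X Pn P F"
  proof (rule weakly_converges_if_converges_on_cells)
    fix I J assume "finite I" "finite J" "I \<subseteq> T" "J \<subseteq> T"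
    then have "converges_on (cell (topspace X) (\<lambda>t. topspace X - H t) J I)"
      using A by (intro converges_on_cells_if_Inter) auto
    then show "converges_on (cell (topspace X) H I J)" by (simp only: cell_complement)
  qed
qed

end

section \<open>Hitting sets in the Fell topology\<close>

definition fell_basic :: "'b::topological_space set \<Rightarrow> 'b set set \<Rightarrow> 'b set set" where
  "fell_basic K \<G> = {F. closed F \<and> F \<inter> K = {} \<and> (\<forall>G\<in>\<G>. F \<inter> G \<noteq> {})}"

lemma fell_basic_Int: "fell_basic K \<G> \<inter> fell_basic K' \<G>' = fell_basic (K \<union> K') (\<G> \<union> \<G>')"
  by (auto simp: fell_basic_def)

lemma fell_open_contains_basic:
  assumes "openin fell_topology U" "F \<in> U"
  shows "\<exists>K \<G>. compact K \<and> finite \<G> \<and> (\<forall>G\<in>\<G>. open G) \<and> F \<in> fell_basic K \<G> \<and> fell_basic K \<G> \<subseteq> U"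
  using openin_topology_generated_by[OF assms(1)[unfolded fell_topology_def]] assms(2)
proof (induction rule: generate_topology_on.induct)
  case (Int a b)
  obtain K \<G> where 1: "compact K" "finite \<G>" "\<forall>G\<in>\<G>. open G" "F \<in> fell_basic K \<G>" "fell_basic K \<G> \<subseteq> a"
    using Int by blast
  obtain K' \<G>' where 2: "compact K'" "finite \<G>'" "\<forall>G\<in>\<G>'. open G" "F \<in> fell_basic K' \<G>'"
      "fell_basic K' \<G>' \<subseteq> b"
    using Int by blast
  show ?case
  proof (intro exI conjI)
    show "F \<in> fell_basic (K \<union> K') (\<G> \<union> \<G>')" "fell_basic (K \<union> K') (\<G> \<union> \<G>') \<subseteq> a \<inter> b"
      using 1 2 by (auto simp flip: fell_basic_Int)
  qed (use 1 2 in auto)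
next
  case (UN \<U>)
  then obtain k where "k \<in> \<U>" "F \<in> k" by blast
  with UN.IH[of k] show ?case by (meson Union_upper order_trans)
next
  case (Basis S)
  then consider K where "compact K" "S = {F. closed F \<and> F \<inter> K = {}}"
    | G where "open G" "S = hit_sets G"
    by blast
  then show ?case
  proof cases
    case 1
    then have "fell_basic K {} = S" by (simp add: fell_basic_def)
    then show ?thesis
      using \<open>compact K\<close> \<open>F \<in> S\<close> by (intro exI[of _ K] exI[of _ "{}"]) simp
  next
    case 2
    then have "fell_basic {} {G} = S" by (simp add: fell_basic_def hit_sets_def)
    then show ?thesis
      using \<open>open G\<close> \<open>F \<in> S\<close> by (intro exI[of _ "{}"] exI[of _ "{G}"]) simp
  qed
qed simp

text \<open>A closed set \<open>F\<close> that misses the interior of \<open>A\<close> can be approximated by finite sets that miss \<open>A\<close>: a basic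
neighbourhood of \<open>F\<close> asks only to avoid a compact set and to hit finitely many open sets, and near
each point of \<open>F\<close> there are points outside \<open>A\<close>.\<close>

lemma interior_of_hit_sets_subset:
  fixes A :: "'b::t2_space set"
  shows "fell_topology interior_of (hit_sets A) \<subseteq> hit_sets (interior A)"
proof
  fix F assume "F \<in> fell_topology interior_of (hit_sets A)"
  then obtain U where U: "openin fell_topology U" "F \<in> U" "U \<subseteq> hit_sets A"
    by (auto simp: interior_of_def)
  then have "closed F" by (auto simp: hit_sets_def)
  obtain K \<G> where "compact K" and fin: "finite \<G>" and opn: "\<forall>G\<in>\<G>. open G"
    and F: "F \<in> fell_basic K \<G>" and sub: "fell_basic K \<G> \<subseteq> U"
    using fell_open_contains_basic[OF U(1,2)] by blast
  have "F \<inter> interior A \<noteq> {}"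
  proof
    assume empty: "F \<inter> interior A = {}"
    \<comment> \<open>Otherwise the open set \<open>G - K\<close> lies in the interior of \<open>A\<close> although it meets \<open>F\<close>.\<close>
    have "\<exists>q. q \<in> G \<and> q \<notin> K \<and> q \<notin> A" if "G \<in> \<G>" for G
    proof (rule ccontr)
      assume "\<nexists>q. q \<in> G \<and> q \<notin> K \<and> q \<notin> A"
      then have "G - K \<subseteq> A" by blast
      moreover have "open (G - K)"
        using opn that \<open>compact K\<close> by (simp add: open_Diff compact_imp_closed)
      ultimately have "G - K \<subseteq> interior A" by (rule interior_maximal)
      then show False using F that empty unfolding fell_basic_def by blast
    qed
    then obtain q where q: "\<And>G. G \<in> \<G> \<Longrightarrow> q G \<in> G \<and> q G \<notin> K \<and> q G \<notin> A" by metis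
    have "closed (q ` \<G>)" using fin by (simp add: finite_imp_closed)
    then have "q ` \<G> \<in> U" using q sub by (auto simp: fell_basic_def)
    then show False using U(3) q by (auto simp: hit_sets_def)
  qed
  then show "F \<in> hit_sets (interior A)" using \<open>closed F\<close> by (simp add: hit_sets_def)
qed

lemma continuity_set_null:
  fixes A :: "'b::t2_space set"
  assumes "continuity_set Q A" "sets Q = sets (borel_of fell_topology)"
  shows "\<exists>N\<in>null_sets Q. hit_sets A - hit_sets (interior A) \<subseteq> N"
proof
  show "fell_topology frontier_of (hit_sets A) \<in> null_sets Q"
    using assms by (simp add: continuity_set_def null_sets_def closedin_sets_borel_of closedin_frontier_of)
  have "hit_sets A \<subseteq> topspace fell_topology"
    by (auto simp: topspace_fell_topology hit_sets_def)
  then have "hit_sets A \<subseteq> fell_topology closure_of (hit_sets A)"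
    by (rule closure_of_subset)
  then show "hit_sets A - hit_sets (interior A) \<subseteq> fell_topology frontier_of (hit_sets A)"
    using interior_of_hit_sets_subset[of A] by (auto simp: frontier_of_def)
qed

section \<open>Lower semicontinuous functions and their epigraphs\<close>

lemma inf_over_antimono: "A \<subseteq> B \<Longrightarrow> inf_over B f \<le> inf_over A f"
  by (simp add: inf_over_def INF_superset_mono)

lemma lsc_functions_open: "f \<in> lsc_functions \<Longrightarrow> open {x. a < f x}"
  by (simp add: lsc_functions_def lower_semicontinuous_def)

text \<open>The strict inequality survives the infimum because finitely many of the open sets \<open>{x. c < f x}\<close> with
\<open>c > a\<close> cover \<open>K\<close>. The bound \<open>a < \<infinity>\<close> matters for the empty \<open>K\<close>, over which the infimum is \<open>\<infinity>\<close>.\<close>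

lemma less_inf_over_compact:
  assumes "f \<in> lsc_functions" "compact K" "\<And>x. x \<in> K \<Longrightarrow> a < f x" "a < \<infinity>"
  shows "a < inf_over K f"
proof -
  have "K \<subseteq> (\<Union>c\<in>{c. a < c}. {x. c < f x})"
    using assms(3) dense by blast
  then obtain C where C: "C \<subseteq> {c. a < c}" "finite C" "K \<subseteq> (\<Union>c\<in>C. {x. c < f x})"
    using compactE_image[OF assms(2), of "{c. a < c}" "\<lambda>c. {x. c < f x}"]
      lsc_functions_open[OF assms(1)] by auto
  define c where "c = Min (insert \<infinity> C)"
  have "a < c" using C assms(4) by (auto simp: c_def)
  moreover have "c \<le> inf_over K f"
    unfolding inf_over_def
  proof (rule INF_greatest)
    fix x assume "x \<in> K"
    then obtain e where "e \<in> C" "e < f x" using C by blast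
    then have "c \<le> e" using C(2) by (simp add: c_def)
    with \<open>e < f x\<close> show "c \<le> f x" by (simp add: less_imp_le)
  qed
  ultimately show ?thesis by (rule less_le_trans)
qed

lemma inf_over_less_iff: "inf_over A f < a \<longleftrightarrow> (\<exists>x\<in>A. f x < a)"
  by (simp add: inf_over_def INF_less_iff)

lemma closed_epigraph:
  fixes f :: "'a::topological_space \<Rightarrow> ereal"
  assumes "f \<in> lsc_functions"
  shows "closed (epigraph f)"
proof -
  have "open (- epigraph f)"
  proof (subst open_subopen, intro ballI)
    fix p assume "p \<in> - epigraph f"
    then obtain x a where p: "p = (x, a)" "ereal a < f x" by (cases p) (auto simp: epigraph_def)
    then obtain c where c: "ereal a < ereal c" "ereal c < f x" using ereal_dense2 by blast
    show "\<exists>T. open T \<and> p \<in> T \<and> T \<subseteq> - epigraph f"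
    proof (intro exI conjI)
      show "open ({x. ereal c < f x} \<times> {..<c})"
        using lsc_functions_open[OF assms] by (intro open_Times) auto
      show "p \<in> {x. ereal c < f x} \<times> {..<c}" using p c by simp
      show "{x. ereal c < f x} \<times> {..<c} \<subseteq> - epigraph f"
        by (auto simp: epigraph_def not_le) (meson ereal_less_eq(3) leD less_le_trans order_less_imp_le)
    qed
  qed
  then show ?thesis by (simp add: closed_def)
qed

lemma openin_epi_compact: "compact K \<Longrightarrow> openin epi_topology {f \<in> lsc_functions. a < inf_over K f}"
  using lower_semicontinuous_inf_over[of K]
  by (simp add: lower_semicontinuous_def topspace_epi_topology)

lemma openin_epi_open: "open G \<Longrightarrow> openin epi_topology {f \<in> lsc_functions. inf_over G f < a}"
  using upper_semicontinuous_inf_over[of G]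
  by (simp add: upper_semicontinuous_def topspace_epi_topology)

lemma openin_epi_epigraph_hits:
  fixes G :: "('a::topological_space \<times> real) set"
  assumes "open G"
  shows "openin epi_topology {f \<in> lsc_functions. epigraph f \<inter> G \<noteq> {}}"
proof (subst openin_subopen, intro ballI, clarsimp)
  fix f :: "'a \<Rightarrow> ereal" assume f: "f \<in> lsc_functions" "epigraph f \<inter> G \<noteq> {}"
  then obtain x a where "(x, a) \<in> G" and fx: "f x \<le> ereal a" by (auto simp: epigraph_def)
  then obtain V W where VW: "open V" "open W" "x \<in> V" "a \<in> W" "V \<times> W \<subseteq> G"
    using assms by (metis open_prod_elim mem_Sigma_iff)
  then obtain e where e: "e > 0" "cball a e \<subseteq> W" by (meson open_contains_cball)
  let ?T = "{g \<in> lsc_functions. inf_over V g < ereal (a + e)}"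
  have "f x < ereal (a + e)"
    by (rule le_less_trans[OF fx]) (use e in simp)
  then have "f \<in> ?T"
    using f VW by (auto simp: inf_over_less_iff)
  moreover have "epigraph g \<inter> G \<noteq> {}" if "g \<in> ?T" for g
  proof -
    from that obtain y where y: "y \<in> V" "g y < ereal (a + e)" by (auto simp: inf_over_less_iff)
    then have "(y, a + e) \<in> epigraph g" by (simp add: epigraph_def less_imp_le)
    moreover have "a + e \<in> W" using e by (auto simp: dist_real_def)
    ultimately show ?thesis using VW y by blast
  qed
  ultimately show "\<exists>T. openin epi_topology T \<and> f \<in> T \<and> T \<subseteq> {f \<in> lsc_functions. epigraph f \<inter> G \<noteq> {}}"
    using openin_epi_open[OF VW(1)] by (intro exI[of _ ?T]) auto
qed

locale proper_metric =
  fixes d :: "'a::t2_space \<Rightarrow> 'a \<Rightarrow> real"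
  assumes proper: "proper_metric_for_topology d"
begin

sublocale Metric_space UNIV d
  using proper by (simp add: proper_metric_for_topology_def)

lemma mtopology_eq: "mtopology = euclidean"
  using proper by (simp add: proper_metric_for_topology_def)

lemma compact_closed_ball: "compact (closed_ball d x r)"
proof -
  have "closed (closed_ball d x r)"
    using closedin_mcball[of x r] by (simp add: mtopology_eq)
  moreover have "compact (closure (closed_ball d x r))"
    using proper mbounded_mcball[of x r] by (simp add: proper_metric_for_topology_def)
  ultimately show ?thesis by (simp add: closure_closed)
qed

lemma open_contains_closed_ball: "open U \<longleftrightarrow> (\<forall>x\<in>U. \<exists>r>0. closed_ball d x r \<subseteq> U)"
  using openin_mtopology_mcball[of U] by (auto simp: mtopology_eq)

lemma mem_interior_closed_ball: "d x y < r \<Longrightarrow> y \<in> interior (closed_ball d x r)"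
proof -
  assume "d x y < r"
  moreover have "open (mball x r)"
    using openin_mball[of x r] by (simp add: mtopology_eq)
  ultimately show ?thesis
    using interior_maximal[OF mball_subset_mcball, of x r] by auto
qed

lemma Metric_space_max_metric: "Metric_space UNIV (max_metric d)"
proof
  fix p q u :: "'a \<times> real"
  show "max_metric d p u \<le> max_metric d p q + max_metric d q u"
    using triangle[of "fst p" "fst q" "fst u"]
    by (auto simp: max_metric_def split: prod.splits)
  show "max_metric d p q = 0 \<longleftrightarrow> p = q"
  proof -
    have "d x y \<le> 0 \<longleftrightarrow> x = y" for x y
      by (metis UNIV_I nonneg order_antisym_conv zero)
    then show ?thesis
      by (cases p; cases q) (auto simp: max_metric_def max_def split: if_splits)
  qed
qed (auto simp: max_metric_def commute abs_minus_commute le_max_iff_disj split: prod.splits)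

lemma closed_ball_max_metric:
  "closed_ball (max_metric d) (x, a) r = closed_ball d x r \<times> {a - r..a + r}"
  unfolding Metric_space.mcball_def[OF Metric_space_max_metric] mcball_def
  by (auto simp: max_metric_def)

lemma lsc_functions_closed_ball:
  assumes "f \<in> lsc_functions" "a < f x"
  shows "\<exists>r>0. a < inf_over (closed_ball d x r) f"
proof -
  obtain r where "r > 0" "closed_ball d x r \<subseteq> {y. a < f y}"
    using lsc_functions_open[OF assms(1), of a] assms(2) open_contains_closed_ball by blast
  then show ?thesis
    using assms compact_closed_ball by (intro exI[of _ r] conjI less_inf_over_compact) auto
qed

text \<open>Around each point \<open>p\<close> of \<open>K\<close> there is a box, the interior of a small closed ball times a half line
below some level \<open>c p\<close>, on whose base \<open>f\<close> stays above that level. Finitely many boxes cover \<open>K\<close>, and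
staying above the levels on their compact bases is an open condition that keeps the epigraph off \<open>K\<close>.\<close>

lemma openin_epi_epigraph_misses:
  assumes "compact K"
  shows "openin epi_topology {f \<in> lsc_functions. epigraph f \<inter> (K :: ('a \<times> real) set) = {}}"
proof (subst openin_subopen, intro ballI, clarsimp)
  fix f :: "'a \<Rightarrow> ereal" assume f: "f \<in> lsc_functions" "epigraph f \<inter> K = {}"
  have "\<exists>c r. 0 < r \<and> snd p < c \<and> ereal c < inf_over (closed_ball d (fst p) r) f" if "p \<in> K" for p
  proof -
    have "ereal (snd p) < f (fst p)"
      using f that by (cases p) (force simp: epigraph_def not_le)
    then obtain c where "ereal (snd p) < ereal c" "ereal c < f (fst p)"
      using ereal_dense2 by blast
    then show ?thesis
      using lsc_functions_closed_ball[OF f(1)] by (metis less_ereal.simps(1))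
  qed
  then obtain c r where cr: "\<And>p. p \<in> K \<Longrightarrow> 0 < r p \<and> snd p < c p \<and>
      ereal (c p) < inf_over (closed_ball d (fst p) (r p)) f"
    by metis
  have "K \<subseteq> (\<Union>p\<in>K. interior (closed_ball d (fst p) (r p)) \<times> {..<c p})"
  proof
    fix p assume p: "p \<in> K"
    have "fst p \<in> interior (closed_ball d (fst p) (r p))"
      using cr[OF p] by (intro mem_interior_closed_ball) simp
    then have "p \<in> interior (closed_ball d (fst p) (r p)) \<times> {..<c p}"
      using cr[OF p] by (cases p) auto
    with p show "p \<in> (\<Union>p\<in>K. interior (closed_ball d (fst p) (r p)) \<times> {..<c p})" by blast
  qed
  then obtain C where C: "C \<subseteq> K" "finite C"
    "K \<subseteq> (\<Union>p\<in>C. interior (closed_ball d (fst p) (r p)) \<times> {..<c p})"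
    by (rule compactE_image[OF assms, rotated]) (auto intro: open_Times)
  let ?T = "cell lsc_functions
    (\<lambda>p. {g \<in> lsc_functions. ereal (c p) < inf_over (closed_ball d (fst p) (r p)) g}) C {}"
  have "openin epi_topology ?T"
    unfolding topspace_epi_topology[symmetric]
    by (intro openin_cell_left C(2))
       (use openin_epi_compact[OF compact_closed_ball] in \<open>simp add: topspace_epi_topology\<close>)
  moreover have "f \<in> ?T" using f cr C(1) by (auto simp: cell_def)
  moreover have "epigraph g \<inter> K = {}" if "g \<in> ?T" for g
  proof (rule ccontr)
    assume "epigraph g \<inter> K \<noteq> {}"
    then obtain y b where yb: "(y, b) \<in> K" "g y \<le> ereal b" by (auto simp: epigraph_def)
    then obtain p where p: "p \<in> C" "y \<in> interior (closed_ball d (fst p) (r p))" "b < c p"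
      using C(3) by blast
    have "ereal (c p) < inf_over (closed_ball d (fst p) (r p)) g"
      using that p(1) by (auto simp: cell_def)
    also have "\<dots> \<le> g y"
      unfolding inf_over_def using p(2) interior_subset by (intro INF_lower) blast
    also have "\<dots> \<le> ereal b" by fact
    finally show False using p(3) by simp
  qed
  moreover have "?T \<subseteq> lsc_functions" by (auto simp: cell_def)
  ultimately show "\<exists>T. openin epi_topology T \<and> f \<in> T \<and> T \<subseteq> {f \<in> lsc_functions. epigraph f \<inter> K = {}}"
    by (intro exI[of _ ?T]) blast
qed

lemma continuous_map_epigraph:
  "continuous_map epi_topology fell_topology (epigraph :: ('a \<Rightarrow> ereal) \<Rightarrow> ('a \<times> real) set)"
  unfolding fell_topology_def
proof (rule continuous_on_generated_topo)
  fix U :: "('a \<times> real) set set"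
  assume "U \<in> {{F. closed F \<and> F \<inter> K = {}} |K. compact K} \<union> {hit_sets G |G. open G}"
  then consider K :: "('a \<times> real) set" where "compact K" "U = {F. closed F \<and> F \<inter> K = {}}"
    | G :: "('a \<times> real) set" where "open G" "U = hit_sets G"
    by blast
  then show "openin epi_topology (epigraph -` U \<inter> topspace epi_topology)"
  proof cases
    case 1
    then have "epigraph -` U \<inter> topspace epi_topology = {f \<in> lsc_functions. epigraph f \<inter> K = {}}"
      by (auto simp: topspace_epi_topology closed_epigraph)
    then show ?thesis using openin_epi_epigraph_misses[OF 1(1)] by simp
  next
    case 2
    then have "epigraph -` U \<inter> topspace epi_topology = {f \<in> lsc_functions. epigraph f \<inter> G \<noteq> {}}"
      by (auto simp: topspace_epi_topology closed_epigraph hit_sets_def)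
    then show ?thesis using openin_epi_epigraph_hits[OF 2(1)] by simp
  qed
next
  have "epigraph f \<in> topspace fell_topology" if "f \<in> topspace epi_topology" for f :: "'a \<Rightarrow> ereal"
    using that by (simp add: topspace_epi_topology topspace_fell_topology closed_epigraph)
  then show "epigraph ` topspace epi_topology \<subseteq>
      \<Union> ({{F. closed F \<and> F \<inter> K = {}} |K. compact K} \<union> {hit_sets G |G. open (G :: ('a \<times> real) set)})"
    unfolding fell_topology_def topology_generated_by_topspace by blast
qed

lemma measurable_epigraph:
  assumes "sets P = sets (borel_of epi_topology)"
  shows "epigraph \<in> measurable P (borel_of (fell_topology :: ('a \<times> real) set topology))"
  unfolding borel_of_def
proof (rule measurable_measure_of)
  have sp: "space P = topspace epi_topology"
    using sets_eq_imp_space_eq[OF assms] by (simp add: space_borel_of)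
  show "epigraph \<in> space P \<rightarrow> topspace (fell_topology :: ('a \<times> real) set topology)"
    using continuous_map_epigraph by (auto simp: continuous_map_def sp)
  fix U assume "U \<in> {U. openin (fell_topology :: ('a \<times> real) set topology) U}"
  then have "openin epi_topology {f \<in> topspace epi_topology. epigraph f \<in> U}"
    using continuous_map_epigraph by (auto simp: continuous_map_def)
  moreover have "epigraph -` U \<inter> space P = {f \<in> topspace epi_topology. epigraph f \<in> U}"
    by (auto simp: sp)
  ultimately show "epigraph -` U \<inter> space P \<in> sets P"
    by (simp add: assms openin_sets_borel_of)
qed (auto dest: openin_subset)

text \<open>The link between radii and the epi-topology. The closed ball of \<open>max_metric d\<close> around \<open>(x, \<alpha>)\<close> is a
product \<open>K\<close> with top level \<open>r + \<alpha>\<close>. If \<open>f\<close> reaches that level on the ball, then its epigraph meets \<open>K\<close>;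
if the epigraph meets the interior of \<open>K\<close>, then \<open>f\<close> is strictly below that level somewhere in the
interior of the ball. So where the implication fails, the epigraph lies in the null frontier of \<open>hit_sets K\<close>.
This also holds for the radii \<open>r \<le> 0\<close> that occur among the differences \<open>q - s k\<close>: for \<open>r < 0\<close> the ball is empty,
and for \<open>r = 0\<close> the interior of \<open>K\<close> is empty.\<close>

lemma continuity_set_AE:
  assumes "sets P = sets (borel_of epi_topology)"
    and cont: "continuity_set (epigraph_distr P) (closed_ball (max_metric d) (x, \<alpha>) r)"
  shows "AE f in P. inf_over (closed_ball d x r) f \<le> ereal (r + \<alpha>) \<longrightarrow>
           inf_over (interior (closed_ball d x r)) f < ereal (r + \<alpha>)"
proof -
  let ?K = "closed_ball d x r \<times> {\<alpha> - r..\<alpha> + r}"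
  have mea: "epigraph \<in> measurable P (borel_of (fell_topology :: ('a \<times> real) set topology))"
    using assms(1) by (rule measurable_epigraph)
  have sp: "space P = lsc_functions"
    using sets_eq_imp_space_eq[OF assms(1)] by (simp add: space_borel_of topspace_epi_topology)
  obtain N where N: "N \<in> null_sets (epigraph_distr P)" "hit_sets ?K - hit_sets (interior ?K) \<subseteq> N"
    using continuity_set_null[OF cont] by (auto simp: epigraph_distr_def closed_ball_max_metric)
  have null: "epigraph -` N \<inter> space P \<in> null_sets P"
    using N(1) mea by (auto simp: epigraph_distr_def null_sets_distr_iff)
  show ?thesis
  proof (rule AE_I'[OF null], rule subsetI)
    fix f assume "f \<in> {f \<in> space P. \<not> (inf_over (closed_ball d x r) f \<le> ereal (r + \<alpha>) \<longrightarrow>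
           inf_over (interior (closed_ball d x r)) f < ereal (r + \<alpha>))}"
    then have f: "f \<in> lsc_functions" and le: "inf_over (closed_ball d x r) f \<le> ereal (r + \<alpha>)"
      and nless: "\<not> inf_over (interior (closed_ball d x r)) f < ereal (r + \<alpha>)"
      by (auto simp: sp)
    have "\<not> (\<forall>y\<in>closed_ball d x r. ereal (r + \<alpha>) < f y)"
    proof
      assume "\<forall>y\<in>closed_ball d x r. ereal (r + \<alpha>) < f y"
      then have "ereal (r + \<alpha>) < inf_over (closed_ball d x r) f"
        using f by (intro less_inf_over_compact compact_closed_ball) auto
      with le show False by simp
    qed
    then obtain y where y: "y \<in> closed_ball d x r" "f y \<le> ereal (r + \<alpha>)"
      by (meson linorder_not_le)
    have "0 \<le> r" using y(1) by (meson in_mcball nonneg order_trans)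
    then have "(y, r + \<alpha>) \<in> epigraph f \<inter> ?K"
      using y by (simp add: epigraph_def)
    then have "epigraph f \<in> hit_sets ?K"
      using closed_epigraph[OF f] by (auto simp only: hit_sets_def)
    moreover have "epigraph f \<notin> hit_sets (interior ?K)"
    proof
      assume "epigraph f \<in> hit_sets (interior ?K)"
      then obtain z b where zb: "z \<in> interior (closed_ball d x r)" "b < \<alpha> + r" "f z \<le> ereal b"
        by (auto simp: hit_sets_def interior_Times epigraph_def)
      then have "f z < ereal (r + \<alpha>)"
        by (intro le_less_trans[OF zb(3)]) simp
      with zb(1) nless show False by (auto simp: inf_over_less_iff)
    qed
    ultimately show "f \<in> epigraph -` N \<inter> space P" using N(2) f by (auto simp: sp)
  qed
qed

section \<open>Countably many cells form a base of the epi-topology\<close>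

lemma closed_ball_between:
  assumes "closure E0 = UNIV" and small: "\<And>\<epsilon>. \<epsilon> > 0 \<Longrightarrow> \<exists>r\<in>D. 0 < r \<and> r < \<epsilon>"
    and "open V" "y \<in> V"
  shows "\<exists>x\<in>E0. \<exists>r\<in>D. y \<in> interior (closed_ball d x r) \<and> closed_ball d x r \<subseteq> V"
proof -
  obtain e where e: "e > 0" "closed_ball d y e \<subseteq> V"
    using assms(3,4) open_contains_closed_ball by blast
  obtain r where r: "r \<in> D" "0 < r" "r < e / 2" using small[of "e / 2"] e by auto
  have "open (mball y r)" "y \<in> mball y r"
    using openin_mball[of y r] r by (simp_all add: mtopology_eq)
  then obtain x where x: "x \<in> E0" "d y x < r"
    using assms(1) closure_iff_nhds_not_empty[of y E0] by (metis Int_iff UNIV_I ex_in_conv in_mball order_refl)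
  have "closed_ball d x r \<subseteq> closed_ball d y e"
    by (rule mcball_subset) (use x r commute[of x y] in auto)
  with e x r show ?thesis
    by (intro bexI[of _ x] bexI[of _ r] conjI mem_interior_closed_ball) (auto simp: commute)
qed

end

lemma rational_level_between:
  assumes "(a :: ereal) < b"
  shows "\<exists>\<alpha>\<in>\<rat>. a < ereal (r + \<alpha>) \<and> ereal (r + \<alpha>) < b"
proof -
  obtain z where z: "a < ereal z" "ereal z < b" using ereal_dense2[OF assms] by blast
  obtain z' where z': "ereal z < ereal z'" "ereal z' < b" using ereal_dense2[OF z(2)] by blast
  then obtain \<alpha> where \<alpha>: "\<alpha> \<in> \<rat>" "z - r < \<alpha>" "\<alpha> < z' - r"
    using Rats_dense_in_real[of "z - r" "z' - r"] by auto
  have "a < ereal (r + \<alpha>)" by (rule less_trans[OF z(1)]) (use \<alpha> in simp)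
  moreover have "ereal (r + \<alpha>) < b" by (rule less_trans[OF _ z'(2)]) (use \<alpha> in simp)
  ultimately show ?thesis using \<alpha> by blast
qed

text \<open>These are the preimages under \<open>epigraph\<close> of the sets hitting the closed balls of \<open>max_metric d\<close>, which
explains the level \<open>r + \<alpha>\<close>.\<close>

definition low_on_ball :: "('a::topological_space \<Rightarrow> 'a \<Rightarrow> real) \<Rightarrow> 'a \<times> real \<times> real \<Rightarrow> ('a \<Rightarrow> ereal) set" where
  "low_on_ball d = (\<lambda>(x, r, \<alpha>). {f \<in> lsc_functions. inf_over (closed_ball d x r) f \<le> ereal (r + \<alpha>)})"

definition low_inside_ball :: "('a::topological_space \<Rightarrow> 'a \<Rightarrow> real) \<Rightarrow> 'a \<times> real \<times> real \<Rightarrow> ('a \<Rightarrow> ereal) set" where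
  "low_inside_ball d = (\<lambda>(x, r, \<alpha>).
     {f \<in> lsc_functions. inf_over (interior (closed_ball d x r)) f < ereal (r + \<alpha>)})"

context proper_metric
begin

lemma closedin_low_on_ball: "closedin epi_topology (low_on_ball d t)"
proof -
  obtain x r \<alpha> where t: "t = (x, r, \<alpha>)" by (cases t)
  have "low_on_ball d t = topspace epi_topology - {f \<in> lsc_functions. ereal (r + \<alpha>) < inf_over (closed_ball d x r) f}"
    by (auto simp: low_on_ball_def t topspace_epi_topology not_less)
  then show ?thesis using openin_epi_compact[OF compact_closed_ball] by auto
qed

lemma openin_low_inside_ball: "openin epi_topology (low_inside_ball d t)"
  by (cases t) (simp add: low_inside_ball_def openin_epi_open)

lemma low_inside_subset_low_on_ball: "low_inside_ball d t \<subseteq> low_on_ball d t"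
proof -
  have "inf_over (closed_ball d x r) f \<le> inf_over (interior (closed_ball d x r)) f" for x r f
    by (intro inf_over_antimono interior_subset)
  then show ?thesis
    by (cases t) (fastforce simp: low_inside_ball_def low_on_ball_def dest: le_less_trans)
qed

text \<open>It suffices to treat the two kinds of subbasic sets. If \<open>f\<close> goes below \<open>a\<close> at a point of an open \<open>G\<close>, one low
set over a small ball inside \<open>G\<close> is enough. If \<open>f\<close> exceeds \<open>a\<close> on a compact \<open>K\<close>, then finitely many small
balls on which \<open>f\<close> is at least some \<open>a' > a\<close> cover \<open>K\<close>, and complements of low sets with levels in
\<open>{a<..<a'}\<close> are used.\<close>

lemma epi_open_contains_cell:
  assumes dense_E0: "closure E0 = UNIV" and small: "\<And>\<epsilon>. \<epsilon> > 0 \<Longrightarrow> \<exists>r\<in>D. 0 < r \<and> r < \<epsilon>"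
    and "openin epi_topology U" "f \<in> U"
  shows "\<exists>I J. finite I \<and> finite J \<and> I \<subseteq> E0 \<times> D \<times> \<rat> \<and> J \<subseteq> E0 \<times> D \<times> \<rat> \<and>
    f \<in> cell lsc_functions (low_on_ball d) I J \<and> cell lsc_functions (low_on_ball d) I J \<subseteq> U"
  using openin_topology_generated_by[OF assms(3)[unfolded epi_topology_def]] assms(4)
proof (induction rule: generate_topology_on.induct)
  case (Int a b)
  let ?T = "E0 \<times> D \<times> \<rat>" and ?cell = "cell lsc_functions (low_on_ball d)"
  obtain I J where 1: "finite I" "finite J" "I \<subseteq> ?T" "J \<subseteq> ?T" "f \<in> ?cell I J" "?cell I J \<subseteq> a"
    using Int by blast
  obtain I' J' where 2: "finite I'" "finite J'" "I' \<subseteq> ?T" "J' \<subseteq> ?T" "f \<in> ?cell I' J'" "?cell I' J' \<subseteq> b"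
    using Int by blast
  show ?case
  proof (intro exI conjI)
    show "f \<in> ?cell (I \<union> I') (J \<union> J')" "?cell (I \<union> I') (J \<union> J') \<subseteq> a \<inter> b"
      using 1 2 by (auto simp flip: cell_Int)
  qed (use 1 2 in auto)
next
  case (UN \<U>)
  then obtain k where "k \<in> \<U>" "f \<in> k" by blast
  with UN.IH[of k] show ?case by (meson Union_upper order_trans)
next
  case (Basis S)
  then consider K a where "compact K" "S = {f \<in> lsc_functions. a < inf_over K f}"
    | G a where "open G" "S = {f \<in> lsc_functions. inf_over G f < a}"
    by blast
  then show ?case
  proof cases
    case 1
    then have f: "f \<in> lsc_functions" "a < inf_over K f" using Basis by auto
    then obtain a' where a': "a < a'" "a' < inf_over K f" using dense by blast
    have "\<exists>t\<in>E0 \<times> D \<times> \<rat>. y \<in> interior (closed_ball d (fst t) (fst (snd t))) \<and> f \<notin> low_on_ball d t \<and>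
        a < ereal (fst (snd t) + snd (snd t))" if "y \<in> K" for y
    proof -
      have "inf_over K f \<le> f y" using that by (simp add: inf_over_def INF_lower)
      then have "y \<in> {z. a' < f z}" using a'(2) by simp
      then obtain x r where xr: "x \<in> E0" "r \<in> D" "y \<in> interior (closed_ball d x r)"
          "closed_ball d x r \<subseteq> {z. a' < f z}"
        using closed_ball_between[OF assms(1) small lsc_functions_open[OF f(1)]] by metis
      obtain \<alpha> where \<alpha>: "\<alpha> \<in> \<rat>" "a < ereal (r + \<alpha>)" "ereal (r + \<alpha>) < a'"
        using rational_level_between[OF a'(1)] by blast
      have "a' \<le> inf_over (closed_ball d x r) f"
        unfolding inf_over_def using xr(4) by (intro INF_greatest less_imp_le) blast
      then have "f \<notin> low_on_ball d (x, r, \<alpha>)"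
        using less_le_trans[OF \<alpha>(3)] by (auto simp: low_on_ball_def not_le[symmetric])
      with xr \<alpha> show ?thesis by (intro bexI[of _ "(x, r, \<alpha>)"]) auto
    qed
    then obtain t where t: "\<And>y. y \<in> K \<Longrightarrow> t y \<in> E0 \<times> D \<times> \<rat>"
      "\<And>y. y \<in> K \<Longrightarrow> y \<in> interior (closed_ball d (fst (t y)) (fst (snd (t y))))"
      "\<And>y. y \<in> K \<Longrightarrow> f \<notin> low_on_ball d (t y)"
      "\<And>y. y \<in> K \<Longrightarrow> a < ereal (fst (snd (t y)) + snd (snd (t y)))"
      by metis
    have "K \<subseteq> (\<Union>y\<in>K. interior (closed_ball d (fst (t y)) (fst (snd (t y)))))"
      using t(2) by blast
    then obtain C where C: "C \<subseteq> K" "finite C"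
        "K \<subseteq> (\<Union>y\<in>C. interior (closed_ball d (fst (t y)) (fst (snd (t y)))))"
      by (rule compactE_image[OF \<open>compact K\<close>, rotated]) auto
    have "cell lsc_functions (low_on_ball d) {} (t ` C) \<subseteq> S"
    proof
      fix g assume g: "g \<in> cell lsc_functions (low_on_ball d) {} (t ` C)"
      have "g \<in> lsc_functions" using g by (simp add: cell_def)
      moreover have "a < inf_over K g"
      proof (rule less_inf_over_compact)
        show "a < \<infinity>" using f(2) by auto
        fix y assume "y \<in> K"
        then obtain c where c: "c \<in> C" "y \<in> interior (closed_ball d (fst (t c)) (fst (snd (t c))))"
          using C(3) by blast
        have "a < ereal (fst (snd (t c)) + snd (snd (t c)))" using t(4) c C(1) by blast
        also have "\<dots> < inf_over (closed_ball d (fst (t c)) (fst (snd (t c)))) g"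
          using g c(1) by (auto simp: cell_def low_on_ball_def case_prod_unfold not_le)
        also have "\<dots> \<le> g y"
          unfolding inf_over_def using c(2) interior_subset by (intro INF_lower) blast
        finally show "a < g y" .
      qed (use calculation \<open>compact K\<close> in auto)
      ultimately show "g \<in> S" using \<open>S = {f \<in> lsc_functions. a < inf_over K f}\<close> by simp
    qed
    moreover have "f \<in> cell lsc_functions (low_on_ball d) {} (t ` C)"
      using f(1) t(3) C(1) by (auto simp: cell_def)
    moreover have "finite (t ` C)" "t ` C \<subseteq> E0 \<times> D \<times> \<rat>" using C(1,2) t(1) by blast+
    ultimately show ?thesis by (intro exI[of _ "{}"] exI[of _ "t ` C"]) simp
  next
    case 2
    then have f: "f \<in> lsc_functions" "inf_over G f < a" using Basis by auto
    then obtain y where y: "y \<in> G" "f y < a" by (auto simp: inf_over_less_iff)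
    obtain x r where xr: "x \<in> E0" "r \<in> D" "y \<in> interior (closed_ball d x r)" "closed_ball d x r \<subseteq> G"
      using closed_ball_between[OF assms(1) small \<open>open G\<close> y(1)] by metis
    obtain \<alpha> where \<alpha>: "\<alpha> \<in> \<rat>" "f y < ereal (r + \<alpha>)" "ereal (r + \<alpha>) < a"
      using rational_level_between[OF y(2)] by blast
    have "inf_over (closed_ball d x r) f \<le> f y"
      unfolding inf_over_def using xr(3) interior_subset by (intro INF_lower) blast
    then have "f \<in> cell lsc_functions (low_on_ball d) {(x, r, \<alpha>)} {}"
      using f(1) \<alpha>(2) by (auto simp: cell_def low_on_ball_def)
    moreover have "cell lsc_functions (low_on_ball d) {(x, r, \<alpha>)} {} \<subseteq> S"
    proof
      fix g assume g: "g \<in> cell lsc_functions (low_on_ball d) {(x, r, \<alpha>)} {}"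
      have "inf_over G g \<le> inf_over (closed_ball d x r) g"
        using xr(4) by (rule inf_over_antimono)
      also have "\<dots> \<le> ereal (r + \<alpha>)" using g by (simp add: cell_def low_on_ball_def)
      also have "\<dots> < a" by fact
      finally show "g \<in> S" using g 2(2) by (simp add: cell_def)
    qed
    ultimately show ?thesis
      using xr \<alpha> by (intro exI[of _ "{(x, r, \<alpha>)}"] exI[of _ "{}"]) auto
  qed
qed simp

end

section \<open>The convergence criterion\<close>

text \<open>Intersections over \<open>j \<in> {1..m}\<close> depend only on the set of the triples, so tuples with repetitions can
be traded for finite index sets.\<close>

lemma all_finite_sequences_iff_all_finite_sets:
  "(\<forall>(m::nat) x r \<alpha>. 1 \<le> m \<and> (\<forall>j\<in>{1..m}. x j \<in> A \<and> r j \<in> B \<and> \<alpha> j \<in> C) \<longrightarrow>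
       \<Phi> ((\<lambda>j. (x j, r j, \<alpha> j)) ` {1..m})) \<longleftrightarrow>
   (\<forall>I. finite I \<and> I \<noteq> {} \<and> I \<subseteq> A \<times> B \<times> C \<longrightarrow> \<Phi> I)"
proof (intro iffI allI impI; elim conjE)
  fix I assume L: "\<forall>(m::nat) x r \<alpha>. 1 \<le> m \<and> (\<forall>j\<in>{1..m}. x j \<in> A \<and> r j \<in> B \<and> \<alpha> j \<in> C) \<longrightarrow>
       \<Phi> ((\<lambda>j. (x j, r j, \<alpha> j)) ` {1..m})"
    and I: "finite I" "I \<noteq> {}" "I \<subseteq> A \<times> B \<times> C"
  obtain h where h: "bij_betw h {1..card I} I" using ex_bij_betw_nat_finite_1[OF I(1)] by blast
  have "1 \<le> card I" using I by (simp add: Suc_le_eq card_gt_0_iff)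
  moreover have "h j \<in> A \<times> B \<times> C" if "j \<in> {1..card I}" for j
    using bij_betwE[OF h] I(3) that by blast
  then have "fst (h j) \<in> A \<and> fst (snd (h j)) \<in> B \<and> snd (snd (h j)) \<in> C" if "j \<in> {1..card I}" for j
    using that by (metis mem_Times_iff)
  ultimately have "\<Phi> ((\<lambda>j. (fst (h j), fst (snd (h j)), snd (snd (h j)))) ` {1..card I})"
    using L[rule_format, of "card I" "\<lambda>j. fst (h j)" "\<lambda>j. fst (snd (h j))" "\<lambda>j. snd (snd (h j))"] by blast
  then show "\<Phi> I" using bij_betw_imp_surj_on[OF h] by simp
next
  fix m :: nat and x r \<alpha>
  assume R: "\<forall>I. finite I \<and> I \<noteq> {} \<and> I \<subseteq> A \<times> B \<times> C \<longrightarrow> \<Phi> I"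
    and "1 \<le> m" "\<forall>j\<in>{1..m}. x j \<in> A \<and> r j \<in> B \<and> \<alpha> j \<in> C"
  then show "\<Phi> ((\<lambda>j. (x j, r j, \<alpha> j)) ` {1..m})"
    by (intro R[rule_format]) auto
qed

lemma radii_arbitrarily_small:
  assumes "\<And>k. 0 < s k" "s \<longlonglongrightarrow> 0" "(\<epsilon> :: real) > 0"
  shows "\<exists>r\<in>radii s. 0 < r \<and> r < \<epsilon>"
proof -
  have "\<forall>\<^sub>F k in sequentially. s k < \<epsilon> / 2"
    using assms by (intro order_tendstoD(2)[of s 0]) auto
  then obtain k where k: "s k < \<epsilon> / 2" by (auto simp: eventually_sequentially)
  obtain q where "q \<in> \<rat>" "0 < q" "q < \<epsilon> / 2"
    using Rats_dense_in_real[of 0 "\<epsilon> / 2"] assms by auto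
  with k assms(1)[of k] show ?thesis
    by (intro bexI[of _ "q + s k"]) (auto simp: radii_def)
qed

lemma countable_radii: "countable (radii s)"
proof -
  have "radii s = (\<lambda>(r, k). r + s k) ` ({r \<in> \<rat>. 0 < r} \<times> UNIV) \<union> (\<lambda>(r, k). r - s k) ` ({r \<in> \<rat>. 0 < r} \<times> UNIV)"
    by (auto simp: radii_def image_iff)
  moreover have "countable {r \<in> \<rat>. (0::real) < r}"
    by (rule countable_subset[OF _ countable_rat]) auto
  ultimately show ?thesis by (simp add: countable_image countable_SIGMA)
qed

lemma borel_measurable_inf_over_open:
  assumes "sets P = sets (borel_of epi_topology)" "open G"
  shows "inf_over G \<in> borel_measurable P"
proof (rule borel_measurableI_less)
  have "space P = lsc_functions"
    using sets_eq_imp_space_eq[OF assms(1)] by (simp add: space_borel_of topspace_epi_topology)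
  then show "{f \<in> space P. inf_over G f < a} \<in> sets P" for a
    using openin_epi_open[OF assms(2)] by (simp add: assms(1) openin_sets_borel_of)
qed

lemma measure_INT_eq_AE:
  assumes "finite I" "I \<noteq> {}"
    and "\<And>t. t \<in> I \<Longrightarrow> A t \<in> sets M" "\<And>t. t \<in> I \<Longrightarrow> B t \<in> sets M"
    and "\<And>t. t \<in> I \<Longrightarrow> AE x in M. x \<in> A t \<longleftrightarrow> x \<in> B t"
  shows "measure M (\<Inter>t\<in>I. A t) = measure M (\<Inter>t\<in>I. B t)"
proof (rule measure_eq_AE)
  have "AE x in M. \<forall>t\<in>I. x \<in> A t \<longleftrightarrow> x \<in> B t"
    using assms(1,5) by (intro AE_finite_allI)
  then show "AE x in M. x \<in> (\<Inter>t\<in>I. A t) \<longleftrightarrow> x \<in> (\<Inter>t\<in>I. B t)"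
    by eventually_elim simp
qed (use assms in \<open>auto intro: sets.finite_INT\<close>)

theorem theorem3:
  fixes d :: "'a::{t2_space, second_countable_topology} \<Rightarrow> 'a \<Rightarrow> real"
    and E0 :: "'a set"
    and le :: "'i \<Rightarrow> 'i \<Rightarrow> bool"
    and Pn :: "'i \<Rightarrow> ('a \<Rightarrow> ereal) measure"
    and P :: "('a \<Rightarrow> ereal) measure"
    and s :: "nat \<Rightarrow> real"
  assumes "locally_compact_space (euclidean :: 'a topology)"
    and "proper_metric_for_topology d"
    and "countable E0" and "closure E0 = UNIV"
    and "directed_preorder le"
    and "\<And>i. prob_space (Pn i)" and "\<And>i. sets (Pn i) = sets (borel_of epi_topology)"
    and "prob_space P" and "sets P = sets (borel_of epi_topology)"
    and "\<And>k. s k \<in> admissible_shifts d E0 (epigraph_distr P)"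
    and "decseq s" and "s \<longlonglongrightarrow> 0"
  defines "D \<equiv> radii s"
  defines "statement1 \<equiv> weakly_converges epi_topology Pn P (net_filter le)"
  defines "statement2 \<equiv>
    (\<forall>(m::nat) (x :: nat \<Rightarrow> 'a) (r :: nat \<Rightarrow> real) (\<alpha> :: nat \<Rightarrow> real).
       1 \<le> m \<and> (\<forall>j\<in>{1..m}. x j \<in> E0 \<and> r j \<in> D \<and> \<alpha> j \<in> \<rat>) \<longrightarrow>
       ((\<lambda>i. measure (Pn i) (\<Inter>j\<in>{1..m}.
           {f \<in> lsc_functions. inf_over (closed_ball d (x j) (r j)) f \<le> ereal (r j + \<alpha> j)}))
        \<longlongrightarrow> measure P (\<Inter>j\<in>{1..m}.
           {f \<in> lsc_functions. inf_over (interior (closed_ball d (x j) (r j))) f \<le> ereal (r j + \<alpha> j)}))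
       (net_filter le))"
  defines "statement3 \<equiv>
    (\<forall>(m::nat) (x :: nat \<Rightarrow> 'a) (r :: nat \<Rightarrow> real) (\<alpha> :: nat \<Rightarrow> real).
       1 \<le> m \<and> (\<forall>j\<in>{1..m}. x j \<in> E0 \<and> r j \<in> D \<and> \<alpha> j \<in> \<rat>) \<longrightarrow>
       ((\<lambda>i. measure (Pn i) (\<Inter>j\<in>{1..m}.
           {f \<in> lsc_functions. inf_over (closed_ball d (x j) (r j)) f > ereal (r j + \<alpha> j)}))
        \<longlongrightarrow> measure P (\<Inter>j\<in>{1..m}.
           {f \<in> lsc_functions. inf_over (interior (closed_ball d (x j) (r j))) f > ereal (r j + \<alpha> j)}))
       (net_filter le))"
  shows "(statement1 \<longleftrightarrow> statement2) \<and> (statement2 \<longleftrightarrow> statement3) \<and>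
    (\<forall>x\<in>E0. \<forall>r\<in>D. \<forall>\<alpha>\<in>\<rat>.
       measure P {f \<in> lsc_functions. inf_over (closed_ball d x r) f \<le> ereal (r + \<alpha>)} =
       measure P {f \<in> lsc_functions. inf_over (interior (closed_ball d x r)) f < ereal (r + \<alpha>)})"
proof -
  let ?T = "E0 \<times> D \<times> (\<rat> :: real set)"
  interpret proper_metric d by unfold_locales fact
  have small: "\<exists>r\<in>D. 0 < r \<and> r < \<epsilon>" if "\<epsilon> > 0" for \<epsilon>
    unfolding D_def using assms(10,12) that
    by (intro radii_arbitrarily_small) (auto simp: admissible_shifts_def)
  have AE_low: "AE f in P. f \<in> low_on_ball d t \<longrightarrow> f \<in> low_inside_ball d t" if "t \<in> ?T" for t
  proof -
    obtain x r \<alpha> where t: "t = (x, r, \<alpha>)" "x \<in> E0" "r \<in> D" "\<alpha> \<in> \<rat>" using \<open>t \<in> ?T\<close> by blast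
    obtain q k where "q \<in> \<rat>" "0 < q" "r = q + s k \<or> r = q - s k"
      using t(3) unfolding D_def radii_def by blast
    then have "continuity_set (epigraph_distr P) (closed_ball (max_metric d) (x, \<alpha>) r)"
      using assms(10)[of k] t(2,4) by (auto simp: admissible_shifts_def)
    from continuity_set_AE[OF assms(9) this] show ?thesis
      by eventually_elim (auto simp: t low_on_ball_def low_inside_ball_def)
  qed
  interpret prob_net epi_topology Pn P "net_filter le"
    by (rule prob_net.intro) (fact assms)+
  interpret cell_base epi_topology Pn P "net_filter le" ?T "low_on_ball d" "low_inside_ball d"
  proof unfold_locales
    show "countable ?T"
      unfolding D_def by (intro countable_SIGMA assms(3) countable_radii countable_rat)
    show "closedin epi_topology (low_on_ball d t)" "openin epi_topology (low_inside_ball d t)"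
      "low_inside_ball d t \<subseteq> low_on_ball d t" for t
      by (rule closedin_low_on_ball openin_low_inside_ball low_inside_subset_low_on_ball)+
    show "\<exists>I J. finite I \<and> finite J \<and> I \<subseteq> ?T \<and> J \<subseteq> ?T \<and>
        f \<in> cell (topspace epi_topology) (low_on_ball d) I J \<and>
        cell (topspace epi_topology) (low_on_ball d) I J \<subseteq> U"
      if "openin epi_topology U" "f \<in> U" for U f
      unfolding topspace_epi_topology using assms(4) small that by (rule epi_open_contains_cell)
  qed (fact AE_low)
  \<comment> \<open>The limits in the statement use the interior of the ball with the non-strict inequality.
    These sets lie between \<open>low_inside_ball\<close> and \<open>low_on_ball\<close>, hence have the same probability.\<close>
  define low_weak where "low_weak = (\<lambda>(x, r, \<alpha>).
      {f \<in> lsc_functions. inf_over (interior (closed_ball d x r)) f \<le> ereal (r + \<alpha>)})"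
  have sets_weak: "low_weak t \<in> sets P" for t
  proof (cases t)
    case (fields x r \<alpha>)
    have [measurable]: "inf_over (interior (closed_ball d x r)) \<in> borel_measurable P"
      using assms(9) by (intro borel_measurable_inf_over_open) auto
    have "{f \<in> space P. inf_over (interior (closed_ball d x r)) f \<le> ereal (r + \<alpha>)} \<in> sets P"
      by measurable
    then show ?thesis by (simp add: low_weak_def fields space_P topspace_epi_topology)
  qed
  have AE_weak: "AE f in P. f \<in> low_on_ball d t \<longleftrightarrow> f \<in> low_weak t" if "t \<in> ?T" for t
  proof -
    have sub: "low_weak t \<subseteq> low_on_ball d t" "low_inside_ball d t \<subseteq> low_weak t"
      using inf_over_antimono[OF interior_subset]
      by (fastforce simp: low_weak_def low_on_ball_def low_inside_ball_def
            intro: order_trans split: prod.splits)+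
    show ?thesis
      using AE_low[OF that] by eventually_elim (use sub in blast)
  qed
  have sets_low: "low_on_ball d t \<in> sets P" "topspace epi_topology - low_on_ball d t \<in> sets P"
      "topspace epi_topology - low_weak t \<in> sets P" if "t \<in> ?T" for t
    using sets_HG[OF that] sets_weak[of t] by (auto simp flip: space_P(1))
  have meas: "(\<Inter>t\<in>I. low_on_ball d t) \<in> sets P"
      "measure P (\<Inter>t\<in>I. low_weak t) = measure P (\<Inter>t\<in>I. low_on_ball d t)"
      "(\<Inter>t\<in>I. topspace epi_topology - low_on_ball d t) \<in> sets P"
      "measure P (\<Inter>t\<in>I. topspace epi_topology - low_weak t) =
        measure P (\<Inter>t\<in>I. topspace epi_topology - low_on_ball d t)"
    if I: "finite I" "I \<noteq> {}" "I \<subseteq> ?T" for I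
  proof -
    show "(\<Inter>t\<in>I. low_on_ball d t) \<in> sets P"
        "(\<Inter>t\<in>I. topspace epi_topology - low_on_ball d t) \<in> sets P"
      using I(3) by (intro sets.finite_INT I sets_low; blast)+
    have AE: "AE f in P. f \<in> low_weak t \<longleftrightarrow> f \<in> low_on_ball d t" if "t \<in> I" for t
      using AE_weak[of t] I(3) that by (auto simp: eq_commute[of "_ \<in> low_weak t"])
    show "measure P (\<Inter>t\<in>I. low_weak t) = measure P (\<Inter>t\<in>I. low_on_ball d t)"
      using I sets_weak sets_low(1) AE by (intro measure_INT_eq_AE) blast+
    have "AE f in P. f \<in> topspace epi_topology - low_weak t \<longleftrightarrow> f \<in> topspace epi_topology - low_on_ball d t"
      if "t \<in> I" for t
      using AE[OF that] by eventually_elim simp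
    then show "measure P (\<Inter>t\<in>I. topspace epi_topology - low_weak t) =
        measure P (\<Inter>t\<in>I. topspace epi_topology - low_on_ball d t)"
      using I sets_low(2,3) by (intro measure_INT_eq_AE) blast+
  qed
  have "statement2 \<longleftrightarrow> (\<forall>I. finite I \<and> I \<noteq> {} \<and> I \<subseteq> ?T \<longrightarrow>
      ((\<lambda>i. measure (Pn i) (\<Inter>t\<in>I. low_on_ball d t)) \<longlongrightarrow> measure P (\<Inter>t\<in>I. low_weak t)) (net_filter le))"
    unfolding statement2_def all_finite_sequences_iff_all_finite_sets[symmetric]
    by (simp add: low_on_ball_def low_weak_def image_image)
  also have "\<dots> \<longleftrightarrow> statement1"
    unfolding statement1_def weakly_converges_iff_Inter converges_on_def
    using meas(1,2) by auto
  finally have 12: "statement2 \<longleftrightarrow> statement1" .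
  have compl: "topspace epi_topology - low_on_ball d (x, r, \<alpha>) =
        {f \<in> lsc_functions. inf_over (closed_ball d x r) f > ereal (r + \<alpha>)}"
      "topspace epi_topology - low_weak (x, r, \<alpha>) =
        {f \<in> lsc_functions. inf_over (interior (closed_ball d x r)) f > ereal (r + \<alpha>)}" for x r \<alpha>
    by (auto simp: low_on_ball_def low_weak_def topspace_epi_topology)
  have "statement3 \<longleftrightarrow> (\<forall>I. finite I \<and> I \<noteq> {} \<and> I \<subseteq> ?T \<longrightarrow>
      ((\<lambda>i. measure (Pn i) (\<Inter>t\<in>I. topspace epi_topology - low_on_ball d t)) \<longlongrightarrow>
        measure P (\<Inter>t\<in>I. topspace epi_topology - low_weak t)) (net_filter le))"
    unfolding statement3_def all_finite_sequences_iff_all_finite_sets[symmetric]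
    by (simp only: compl image_image)
  also have "\<dots> \<longleftrightarrow> statement1"
    unfolding statement1_def weakly_converges_iff_Inter_complement converges_on_def
    using meas(3,4) by auto
  finally have 13: "statement3 \<longleftrightarrow> statement1" .
  have "measure P (low_on_ball d t) = measure P (low_inside_ball d t)" if "t \<in> ?T" for t
    using AE_H_iff_G[OF that] sets_HG[OF that] by (rule measure_eq_AE)
  then have "\<forall>x\<in>E0. \<forall>r\<in>D. \<forall>\<alpha>\<in>\<rat>.
       measure P {f \<in> lsc_functions. inf_over (closed_ball d x r) f \<le> ereal (r + \<alpha>)} =
       measure P {f \<in> lsc_functions. inf_over (interior (closed_ball d x r)) f < ereal (r + \<alpha>)}"
    by (fastforce simp: low_on_ball_def low_inside_ball_def)
  with 12 13 show ?thesis by blast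
qed

end
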